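(* Let $n\ge 2$, let $B\subset\mathbb{Z}^n$ be an $n$-box, and let $f:\partial B\to\mathbb{Z}^{n-1}$ be $(c_n,c_1)$-continuous. Then there is some point $x\in\partial B$ such that $f(x)$ and $f(-x)$ are equal or $c_1$-adjacent.
   Context: For integers $1\le k\le N$, two distinct points of $\mathbb{Z}^N$ are $c_k$-adjacent if their coordinates differ by at most 1 in at most $k$ positions and are equal in all other positions. Subsets of $\mathbb{Z}^N$ carry the restricted relation. A function $f$ from a set with adjacency $\kappa$ to a set with adjacency $\lambda$ is $(\kappa,\lambda)$-continuous if whenever $a,b$ are $\kappa$-adjacent, $f(a)$ and $f(b)$ are $\lambda$-adjacent or equal. An $n$-box is a set $B=\prod_{i=1}^n\{a_i,a_i+1,\dots,b_i\}\subset\mathbb{Z}^n$ with $a_i,b_i\in\mathbb{Z}$ and $a_i<b_i$ for each $i$. Its boundary is $\partial B=\bigcup_{i=1}^n(\{x\in B:x_i=a_i\}\cup\{x\in B:x_i=b_i\})$. For $x\in B$, $-x$ denotes the antipodal point $(a_1+b_1-x_1,\dots,a_n+b_n-x_n)$ (not the additive inverse); this map preserves $\partial B$. *)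

theory Defs
  imports Main "HOL-Library.FuncSet"
begin

text \<open>Points of \<open>\<int>\<^sup>N\<close> are integer-valued functions on the index set \<open>{1..N}\<close>,
  extensional outside it so that equality of points is equality of functions.\<close>

definition lattice_points :: "nat \<Rightarrow> (nat \<Rightarrow> int) set" where
  "lattice_points N = {1..N} \<rightarrow>\<^sub>E UNIV"

text \<open>\<open>c_adj N k\<close> is the relation \<open>c\<^sub>k\<close> on \<open>\<int>\<^sup>N\<close>; it is meant for \<open>1 \<le> k \<le> N\<close>.\<close>

definition c_adj :: "nat \<Rightarrow> nat \<Rightarrow> (nat \<Rightarrow> int) \<Rightarrow> (nat \<Rightarrow> int) \<Rightarrow> bool" where
  "c_adj N k x y \<longleftrightarrow>
     x \<in> lattice_points N \<and> y \<in> lattice_points N \<and> x \<noteq> y \<and>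
     (\<exists>S\<subseteq>{1..N}. card S \<le> k \<and>
        (\<forall>i\<in>S. \<bar>x i - y i\<bar> \<le> 1) \<and> (\<forall>i\<in>{1..N} - S. x i = y i))"

definition digitally_continuous ::
    "'a set \<Rightarrow> ('a \<Rightarrow> 'a \<Rightarrow> bool) \<Rightarrow> 'b set \<Rightarrow> ('b \<Rightarrow> 'b \<Rightarrow> bool) \<Rightarrow> ('a \<Rightarrow> 'b) \<Rightarrow> bool" where
  "digitally_continuous X \<kappa> Y \<mu> f \<longleftrightarrow>
     f \<in> X \<rightarrow> Y \<and> (\<forall>a\<in>X. \<forall>b\<in>X. \<kappa> a b \<longrightarrow> \<mu> (f a) (f b) \<or> f a = f b)"

text \<open>The following three notions are used for bounds with \<open>a i < b i\<close> for all \<open>i\<close> in \<open>{1..n}\<close>,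
  in which case the box determines the values of the bounds on \<open>{1..n}\<close>.\<close>

definition int_box :: "nat \<Rightarrow> (nat \<Rightarrow> int) \<Rightarrow> (nat \<Rightarrow> int) \<Rightarrow> (nat \<Rightarrow> int) set" where
  "int_box n a b = (\<Pi>\<^sub>E i\<in>{1..n}. {a i..b i})"

definition box_boundary :: "nat \<Rightarrow> (nat \<Rightarrow> int) \<Rightarrow> (nat \<Rightarrow> int) \<Rightarrow> (nat \<Rightarrow> int) set" where
  "box_boundary n a b =
     (\<Union>i\<in>{1..n}. {x \<in> int_box n a b. x i = a i} \<union> {x \<in> int_box n a b. x i = b i})"

definition antipode :: "nat \<Rightarrow> (nat \<Rightarrow> int) \<Rightarrow> (nat \<Rightarrow> int) \<Rightarrow> (nat \<Rightarrow> int) \<Rightarrow> (nat \<Rightarrow> int)" where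
  "antipode n a b x = (\<lambda>i\<in>{1..n}. a i + b i - x i)"

lemma antipode_in_box_boundary:
  assumes "x \<in> box_boundary n a b"
  shows "antipode n a b x \<in> box_boundary n a b"
proof -
  obtain i where i: "i \<in> {1..n}" "x \<in> int_box n a b" "x i = a i \<or> x i = b i"
    using assms unfolding box_boundary_def by blast
  have "antipode n a b x \<in> int_box n a b"
    using i(2) unfolding antipode_def int_box_def by (fastforce simp: PiE_iff)
  moreover have "antipode n a b x i = a i \<or> antipode n a b x i = b i"
    using i(1,3) by (auto simp: antipode_def)
  ultimately show ?thesis
    using i(1) unfolding box_boundary_def by blast
qed

end

theory Submission
  imports Defs
begin

text \<open>
  Two points of the boundary that lie in a common unit cell are \<open>c\<^sub>n\<close>-adjacent, while \<open>\<int>\<^sup>m\<close> with the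
  adjacency \<open>c\<^sub>1\<close> contains no triangle (adjacent points have coordinate sums of opposite parity).
  So a continuous \<open>f\<close> takes at most two values on each clique of the boundary: it behaves like a
  simplicial map from a sphere to a graph.

  For \<open>n \<ge> 3\<close> the sphere is simply connected, and such a map factors through a tree, whose
  vertices are the connected components of the fibres of \<open>f\<close>. If a fibre component \<open>K\<close> meets its
  antipode, then \<open>f x = f (-x)\<close> for some \<open>x\<close>. If none does, the antipode of each \<open>K\<close> lies on one side
  of \<open>K\<close>, so \<open>K\<close> points along one edge of the tree.
  As in every finite tree whose vertices all point to a neighbour, there are neighbours \<open>K\<close> and
  \<open>K'\<close> that point to each other, and between them one finds adjacent \<open>x\<close>, \<open>y\<close> with
  \<open>f (-x) = f y\<close>; since \<open>f y\<close> is equal or adjacent to \<open>f x\<close>, the point \<open>x\<close> is as required. This is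
  \<open>near_coincidence\<close>. The tree itself is never built: that removing an edge separates it is the statement \<open>cut_edges_linked\<close>,
  that the edges across a cut of a simply connected set are linked through triangles.

  The form of simple connectivity that this needs is that every mod 2 cocycle on edges is a
  coboundary. It holds for boxes and for the boundary without its top face, because these can be
  collapsed layer by layer (\<open>simply_conn_fold\<close>), and it passes to the whole boundary by gluing on
  the top face (\<open>simply_conn_glue\<close>), as the layer below that face is connected for \<open>n \<ge> 3\<close>
  (\<open>simply_conn_shell\<close>).

  For \<open>n = 2\<close> the boundary is a circle, and \<open>f x - f (-x)\<close> is an integer that changes by at most 2 along
  each edge and takes opposite values at antipodes, so it comes within 1 of zero
  (\<open>coincidence_on_circle\<close>).
\<close>

section \<open>Connected and simply connected sets of vertices\<close>

locale reflexive_graph =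
  fixes E :: "'a \<Rightarrow> 'a \<Rightarrow> bool"
  assumes E_refl: "E x x"
    and E_sym: "E x y \<Longrightarrow> E y x"
begin

text \<open>Connectivity is stated as a rule for transporting predicates along edges, the form in
  which it is used; applied to membership in a component it is the usual notion.\<close>

definition conn :: "'a set \<Rightarrow> bool" where
  "conn S \<longleftrightarrow> (\<forall>P. (\<forall>x\<in>S. \<forall>y\<in>S. E x y \<longrightarrow> P x \<longrightarrow> P y) \<longrightarrow> (\<forall>x\<in>S. \<forall>y\<in>S. P x \<longrightarrow> P y))"

text \<open>These are the 1-cocycles and 1-coboundaries with values in \<open>\<int>/2\<close> of the clique complex, where
  addition is exclusive or, that is, inequality of truth values. Degenerate triangles
  \<open>x, x, x\<close> and \<open>x, y, x\<close> make a cocycle vanish on loops and be symmetric.\<close>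

definition cocycle_on :: "'a set \<Rightarrow> ('a \<Rightarrow> 'a \<Rightarrow> bool) \<Rightarrow> bool" where
  "cocycle_on S \<phi> \<longleftrightarrow>
     (\<forall>x\<in>S. \<forall>y\<in>S. \<forall>z\<in>S. E x y \<longrightarrow> E y z \<longrightarrow> E x z \<longrightarrow> \<phi> x z = (\<phi> x y \<noteq> \<phi> y z))"

definition coboundary_on :: "'a set \<Rightarrow> ('a \<Rightarrow> 'a \<Rightarrow> bool) \<Rightarrow> bool" where
  "coboundary_on S \<phi> \<longleftrightarrow> (\<exists>\<psi> :: 'a \<Rightarrow> bool. \<forall>x\<in>S. \<forall>y\<in>S. E x y \<longrightarrow> \<phi> x y = (\<psi> x \<noteq> \<psi> y))"

text \<open>Properly speaking, this says that the clique complex is connected with vanishing first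
  cohomology over \<open>\<int>/2\<close>. Unlike triviality of the fundamental group, it requires no calculus
  of paths.\<close>

definition simply_conn :: "'a set \<Rightarrow> bool" where
  "simply_conn S \<longleftrightarrow> conn S \<and> (\<forall>\<phi>. cocycle_on S \<phi> \<longrightarrow> coboundary_on S \<phi>)"

lemma connI:
  assumes "\<And>P x y. (\<And>x y. x \<in> S \<Longrightarrow> y \<in> S \<Longrightarrow> E x y \<Longrightarrow> P x \<Longrightarrow> P y) \<Longrightarrow> x \<in> S \<Longrightarrow> y \<in> S \<Longrightarrow> P x \<Longrightarrow> P y"
  shows "conn S"
  unfolding conn_def using assms by blast

lemma connD:
  assumes "conn S" "\<And>x y. x \<in> S \<Longrightarrow> y \<in> S \<Longrightarrow> E x y \<Longrightarrow> P x \<Longrightarrow> P y" "x \<in> S" "y \<in> S" "P x"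
  shows "P y"
  using assms unfolding conn_def by blast

lemma simply_conn_potential:
  assumes "simply_conn S" "cocycle_on S \<phi>"
  obtains \<psi> :: "'a \<Rightarrow> bool"
    where "\<And>x y. x \<in> S \<Longrightarrow> y \<in> S \<Longrightarrow> E x y \<Longrightarrow> \<phi> x y = (\<psi> x \<noteq> \<psi> y)"
proof -
  have "coboundary_on S \<phi>" using assms by (simp add: simply_conn_def)
  then show thesis using that by (auto simp: coboundary_on_def)
qed

text \<open>Symmetry of edges makes invariance of \<open>P\<close> two-sided, so comparison with one point suffices.\<close>

lemma conn_base_point:
  assumes "c \<in> S"
    and "\<And>P x. (\<And>x y. x \<in> S \<Longrightarrow> y \<in> S \<Longrightarrow> E x y \<Longrightarrow> P x \<longleftrightarrow> P y) \<Longrightarrow> x \<in> S \<Longrightarrow> P x \<longleftrightarrow> P c"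
  shows "conn S"
proof (rule connI)
  fix P x y
  assume inv: "\<And>x y. x \<in> S \<Longrightarrow> y \<in> S \<Longrightarrow> E x y \<Longrightarrow> P x \<Longrightarrow> P y" and xy: "x \<in> S" "y \<in> S" "P x"
  have "P u \<longleftrightarrow> P v" if "u \<in> S" "v \<in> S" "E u v" for u v
    using inv that E_sym by blast
  from assms(2)[of P, OF this] show "P y" using xy by blast
qed

lemma conn_constant:
  assumes "conn S" "\<And>x y. x \<in> S \<Longrightarrow> y \<in> S \<Longrightarrow> E x y \<Longrightarrow> P x \<longleftrightarrow> P y" "x \<in> S" "y \<in> S"
  shows "P x \<longleftrightarrow> P y"
  using connD[OF assms(1), of P x y] connD[OF assms(1), of P y x] assms(2-) by blast

lemma conn_image:
  assumes "conn S" "\<And>x y. x \<in> S \<Longrightarrow> y \<in> S \<Longrightarrow> E x y \<Longrightarrow> E (g x) (g y)"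
  shows "conn (g ` S)"
proof (rule connI)
  fix P x y
  assume inv: "\<And>x y. x \<in> g ` S \<Longrightarrow> y \<in> g ` S \<Longrightarrow> E x y \<Longrightarrow> P x \<Longrightarrow> P y"
    and "x \<in> g ` S" "y \<in> g ` S" "P x"
  then obtain u v where "u \<in> S" "v \<in> S" "x = g u" "y = g v" by blast
  then show "P y"
    using connD[OF assms(1), of "\<lambda>z. P (g z)" u v] inv assms(2) \<open>P x\<close> by blast
qed

lemma conn_union:
  assumes "conn S" "conn T" "s \<in> S" "t \<in> T" "E s t"
  shows "conn (S \<union> T)"
proof (rule conn_base_point)
  show "s \<in> S \<union> T" using assms by blast
  fix P x
  assume inv: "\<And>x y. x \<in> S \<union> T \<Longrightarrow> y \<in> S \<union> T \<Longrightarrow> E x y \<Longrightarrow> P x \<longleftrightarrow> P y" and "x \<in> S \<union> T"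
  then show "P x \<longleftrightarrow> P s"
    using conn_constant[OF assms(1), of P x s] conn_constant[OF assms(2), of P x t] assms(3-)
    by blast
qed

lemma conn_boundary:
  assumes "conn S" "A \<subseteq> S" "A \<noteq> {}" "A \<noteq> S"
  shows "\<exists>x\<in>A. \<exists>y\<in>S - A. E x y"
proof -
  obtain x y where "x \<in> A" "y \<in> S - A" using assms by blast
  then have "\<not> (\<forall>x\<in>S. \<forall>y\<in>S. E x y \<longrightarrow> x \<in> A \<longrightarrow> y \<in> A)"
    using connD[OF assms(1), of "\<lambda>z. z \<in> A" x y] assms(2) by blast
  then show ?thesis using assms(2) by blast
qed

definition component :: "'a set \<Rightarrow> 'a \<Rightarrow> 'a set" where
  "component S x = {y. (\<lambda>u v. v \<in> S \<and> E u v)\<^sup>*\<^sup>* x y}"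

lemma component_self: "x \<in> component S x"
  by (simp add: component_def)

lemma component_subset: "x \<in> S \<Longrightarrow> component S x \<subseteq> S"
  by (auto simp: component_def elim: rtranclp.cases)

lemma component_closed: "y \<in> component S x \<Longrightarrow> z \<in> S \<Longrightarrow> E y z \<Longrightarrow> z \<in> component S x"
  unfolding component_def by (auto intro: rtranclp.rtrancl_into_rtrancl)

lemma conn_component: "conn (component S x)"
proof (rule conn_base_point)
  show "x \<in> component S x" by (rule component_self)
  fix P y
  assume inv: "\<And>u v. u \<in> component S x \<Longrightarrow> v \<in> component S x \<Longrightarrow> E u v \<Longrightarrow> P u \<longleftrightarrow> P v"
  assume "y \<in> component S x"
  then have "(\<lambda>u v. v \<in> S \<and> E u v)\<^sup>*\<^sup>* x y" by (simp add: component_def)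
  then have "y \<in> component S x \<and> (P y \<longleftrightarrow> P x)"
  proof induction
    case base
    then show ?case by (simp add: component_self)
  next
    case (step y z)
    then show ?case using component_closed inv by blast
  qed
  then show "P y \<longleftrightarrow> P x" ..
qed

lemma component_maximal:
  assumes "conn A" "A \<subseteq> S" "x \<in> S" "y \<in> A" "y \<in> component S x"
  shows "A \<subseteq> component S x"
proof
  fix z assume "z \<in> A"
  then show "z \<in> component S x"
    using connD[OF assms(1), of "\<lambda>z. z \<in> component S x" y z] assms component_closed by blast
qed

section \<open>Cuts of simply connected sets\<close>

text \<open>A family \<open>Q\<close> of edges across the cut that is closed under passing to an edge of a common
  triangle, extended by zero to the other edges, is a cocycle: a triangle has either no cut edges
  or two, which are both in the family or both outside. A potential of this cocycle is constant on
  either side of the cut, so its jump is the same across all cut edges, and the family is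
  empty or full.\<close>

lemma cut_edges_linked:
  assumes X: "simply_conn X"
    and part: "U \<subseteq> X" "conn U" "conn (X - U)"
    and Q1: "\<And>u u' w. u \<in> U \<Longrightarrow> u' \<in> U \<Longrightarrow> w \<in> X - U \<Longrightarrow> E u u' \<Longrightarrow> E u w \<Longrightarrow> E u' w \<Longrightarrow> Q u w \<Longrightarrow> Q u' w"
    and Q2: "\<And>u w w'. u \<in> U \<Longrightarrow> w \<in> X - U \<Longrightarrow> w' \<in> X - U \<Longrightarrow> E w w' \<Longrightarrow> E u w \<Longrightarrow> E u w' \<Longrightarrow> Q u w \<Longrightarrow> Q u w'"
    and e0: "u0 \<in> U" "w0 \<in> X - U" "E u0 w0" "Q u0 w0"
    and e: "u \<in> U" "w \<in> X - U" "E u w"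
  shows "Q u w"
proof -
  define \<phi> where "\<phi> x y \<longleftrightarrow> (x \<in> U \<and> y \<notin> U \<and> Q x y) \<or> (y \<in> U \<and> x \<notin> U \<and> Q y x)" for x y
  have R1: "Q u w \<longleftrightarrow> Q u' w"
    if "u \<in> U" "u' \<in> U" "w \<in> X - U" "E u u'" "E u w" "E u' w" for u u' w
    using Q1[OF that] Q1[OF that(2,1,3) E_sym[OF that(4)] that(6,5)] by blast
  have R2: "Q u w \<longleftrightarrow> Q u w'"
    if "u \<in> U" "w \<in> X - U" "w' \<in> X - U" "E w w'" "E u w" "E u w'" for u w w'
    using Q2[OF that] Q2[OF that(1,3,2) E_sym[OF that(4)] that(6,5)] by blast
  have "cocycle_on X \<phi>"
    unfolding cocycle_on_def
  proof (intro ballI impI)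
    fix x y z assume X: "x \<in> X" "y \<in> X" "z \<in> X" and E: "E x y" "E y z" "E x z"
    note E' = E[THEN E_sym]
    consider "x \<in> U" "y \<in> U" "z \<in> U" | "x \<in> U" "y \<in> U" "z \<notin> U"
      | "x \<in> U" "y \<notin> U" "z \<in> U" | "x \<in> U" "y \<notin> U" "z \<notin> U"
      | "x \<notin> U" "y \<in> U" "z \<in> U" | "x \<notin> U" "y \<in> U" "z \<notin> U"
      | "x \<notin> U" "y \<notin> U" "z \<in> U" | "x \<notin> U" "y \<notin> U" "z \<notin> U" by blast
    then show "\<phi> x z = (\<phi> x y \<noteq> \<phi> y z)"
    proof cases
      case 2
      with R1[of x y z] X E show ?thesis by (simp add: \<phi>_def)
    next
      case 3
      with R1[of x z y] X E E' show ?thesis by (simp add: \<phi>_def)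
    next
      case 4
      with R2[of x y z] X E show ?thesis by (simp add: \<phi>_def)
    next
      case 5
      with R1[of y z x] X E E' show ?thesis by (simp add: \<phi>_def)
    next
      case 6
      with R2[of y x z] X E E' show ?thesis by (simp add: \<phi>_def)
    next
      case 7
      with R2[of z x y] X E E' show ?thesis by (simp add: \<phi>_def)
    qed (simp_all add: \<phi>_def)
  qed
  from simply_conn_potential[OF X this] obtain \<psi> :: "'a \<Rightarrow> bool"
    where \<psi>: "\<And>x y. x \<in> X \<Longrightarrow> y \<in> X \<Longrightarrow> E x y \<Longrightarrow> \<phi> x y = (\<psi> x \<noteq> \<psi> y)" by metis
  have "\<psi> x = \<psi> y" if "x \<in> U" "y \<in> U" "E x y" for x y
    using \<psi>[of x y] that part(1) by (auto simp: \<phi>_def)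
  then have "\<psi> u = \<psi> u0"
    using conn_constant[OF part(2), of \<psi> u u0] e e0 by blast
  moreover have "\<psi> x = \<psi> y" if "x \<in> X - U" "y \<in> X - U" "E x y" for x y
    using \<psi>[of x y] that by (auto simp: \<phi>_def)
  then have "\<psi> w = \<psi> w0"
    using conn_constant[OF part(3), of \<psi> w w0] e e0 by blast
  ultimately have "\<phi> u w = \<phi> u0 w0"
    using \<psi>[of u w] \<psi>[of u0 w0] e e0 part(1) by auto
  then show ?thesis using e e0 by (auto simp: \<phi>_def)
qed

text \<open>Every other component of \<open>X - K\<close> touches \<open>K\<close>, as it would otherwise be cut off
  in \<open>X\<close>; so \<open>K\<close> holds the other components together.\<close>

lemma conn_diff_component:
  assumes X: "conn X" and K: "conn K" "K \<subseteq> X" "K \<noteq> {}" and "p \<in> X - K"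
  shows "conn (X - component (X - K) p)"
proof -
  define U where "U = component (X - K) p"
  have U: "U \<subseteq> X - K" unfolding U_def using component_subset[OF \<open>p \<in> X - K\<close>] .
  obtain k where k: "k \<in> K" using K by blast
  have "conn (X - U)"
  proof (rule conn_base_point)
    show "k \<in> X - U" using k K U by blast
    fix P w
    assume inv: "\<And>x y. x \<in> X - U \<Longrightarrow> y \<in> X - U \<Longrightarrow> E x y \<Longrightarrow> P x \<longleftrightarrow> P y" and w: "w \<in> X - U"
    have onK: "P y \<longleftrightarrow> P k" if "y \<in> K" for y
      using conn_constant[OF K(1), of P y k] inv K U that k by blast
    show "P w \<longleftrightarrow> P k"
    proof (cases "w \<in> K")
      case True
      then show ?thesis by (rule onK)
    next
      case False
      define C where "C = component (X - K) w"
      have C: "C \<subseteq> X - K" "w \<in> C" "conn C"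
        using False w component_subset component_self conn_component unfolding C_def by auto
      have "C \<inter> U = {}"
      proof (rule ccontr)
        assume "C \<inter> U \<noteq> {}"
        then obtain z where "z \<in> C" "z \<in> U" by blast
        then have "C \<subseteq> U"
          using component_maximal[OF C(3) C(1) \<open>p \<in> X - K\<close>] unfolding U_def by blast
        then show False using C(2) w by blast
      qed
      obtain c y where cy: "c \<in> C" "y \<in> X - C" "E c y"
        using conn_boundary[OF X, of C] C K(2) k by auto
      have "y \<in> K"
        using component_closed[of c "X - K" w y] cy unfolding C_def by blast
      have "P w \<longleftrightarrow> P c"
        using conn_constant[OF C(3), of P w c] inv C cy(1) \<open>C \<inter> U = {}\<close> by blast
      also have "\<dots> \<longleftrightarrow> P y"
        using inv[of c y] cy C U \<open>y \<in> K\<close> \<open>C \<inter> U = {}\<close> by blast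
      also have "\<dots> \<longleftrightarrow> P k" using onK \<open>y \<in> K\<close> .
      finally show ?thesis .
    qed
  qed
  then show ?thesis by (simp add: U_def)
qed

section \<open>A near-coincidence theorem\<close>

text \<open>The hypothesis on \<open>f\<close> makes it a map to a graph, and the conclusion is a discrete form of
  the fixed point property of trees. Suppose the conclusion fails. Each fibre component \<open>K x\<close> is then
  disjoint from its image under \<open>\<alpha>\<close>, which lies in one component \<open>U x\<close> of the complement: this is the
  branch of the tree that \<open>K x\<close> points to. If \<open>U x\<close> has the least possible size, then the fibre component
  \<open>K u0\<close> at which one enters \<open>U x\<close> cannot point to a smaller branch inside \<open>U x\<close>, so it points back.
  An edge \<open>u0\<close>, \<open>w0\<close> between the two is therefore reversed by \<open>\<alpha>\<close>: \<open>\<alpha> w0\<close> lies in \<open>K u0\<close>.\<close>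

theorem near_coincidence:
  assumes X: "simply_conn X" "finite X" "X \<noteq> {}"
    and \<alpha>: "\<And>x. x \<in> X \<Longrightarrow> \<alpha> x \<in> X" "\<And>x y. x \<in> X \<Longrightarrow> y \<in> X \<Longrightarrow> E x y \<Longrightarrow> E (\<alpha> x) (\<alpha> y)"
    and f: "\<And>x y z. x \<in> X \<Longrightarrow> y \<in> X \<Longrightarrow> z \<in> X \<Longrightarrow> E x y \<Longrightarrow> E y z \<Longrightarrow> E x z \<Longrightarrow>
              f x = f y \<or> f y = f z \<or> f x = f z"
  shows "\<exists>x\<in>X. \<exists>y\<in>X. E x y \<and> f (\<alpha> x) = f y"
proof (rule ccontr)
  assume "\<not> ?thesis"
  then have no: "\<And>x y. x \<in> X \<Longrightarrow> y \<in> X \<Longrightarrow> E x y \<Longrightarrow> f (\<alpha> x) \<noteq> f y" by blast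
  have connX: "conn X" using X(1) by (simp add: simply_conn_def)
  define K where "K x = component {y \<in> X. f y = f x} x" for x
  define U where "U x = component (X - K x) (\<alpha> x)" for x
  have K: "x \<in> K x" "conn (K x)" "K x \<subseteq> X" "\<And>y. y \<in> K x \<Longrightarrow> f y = f x" if "x \<in> X" for x
    using component_self conn_component component_subset[of x "{y \<in> X. f y = f x}"] that unfolding K_def by auto
  have K_closed: "z \<in> K x" if "y \<in> K x" "z \<in> X" "E y z" "f z = f x" for x y z
    using component_closed that unfolding K_def by blast
  have \<alpha>K: "\<alpha> y \<in> X - K x" if "x \<in> X" "y \<in> K x" for x y
  proof -
    have y: "y \<in> X" using K(3)[OF that(1)] that(2) by blast
    then have "f (\<alpha> y) \<noteq> f x"
      using no[OF y y E_refl] K(4)[OF that] by simp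
    then show ?thesis using \<alpha>(1)[OF y] K(4)[OF that(1), of "\<alpha> y"] by blast
  qed
  have U: "U x \<subseteq> X - K x" "conn (U x)" "\<alpha> x \<in> U x" if "x \<in> X" for x
    using component_subset[OF \<alpha>K[OF that K(1)[OF that]]] conn_component component_self unfolding U_def by auto
  have U_closed: "z \<in> U x" if "y \<in> U x" "z \<in> X - K x" "E y z" for x y z
    using component_closed that unfolding U_def by blast
  have \<alpha>KU: "\<alpha> y \<in> U x" if "x \<in> X" "y \<in> K x" for x y
  proof -
    have "conn (\<alpha> ` K x)"
      using conn_image[OF K(2)] K(3) \<alpha>(2) that(1) by blast
    then have "\<alpha> ` K x \<subseteq> U x"
      unfolding U_def
      using component_maximal[of "\<alpha> ` K x" "X - K x" "\<alpha> x" "\<alpha> x"] \<alpha>K[OF that(1)] K(1)[OF that(1)] component_self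
      by blast
    then show ?thesis using that(2) by blast
  qed
  obtain x where x: "x \<in> X" and min: "\<And>y. y \<in> X \<Longrightarrow> card (U x) \<le> card (U y)"
    using X(3) ex_has_least_nat[of "\<lambda>x. x \<in> X" _ "\<lambda>x. card (U x)"] by blast
  let ?W = "X - U x"
  have connW: "conn ?W"
    using conn_diff_component[OF connX K(2) K(3), OF x x _ \<alpha>K[OF x K(1)[OF x]]] K(1)[OF x]
    unfolding U_def by blast
  have UX: "U x \<subseteq> X" "x \<in> ?W" using U(1)[OF x] K(1)[OF x] x by blast+
  obtain u0 w0 where e0: "u0 \<in> U x" "w0 \<in> ?W" "E u0 w0"
    using conn_boundary[OF connX UX(1)] U(3)[OF x] UX(2) by auto
  have wK: "w \<in> K x" if "u \<in> U x" "w \<in> ?W" "E u w" for u w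
    using U_closed[OF that(1) _ that(3)] that by blast
  have fu: "f u \<noteq> f x" if "u \<in> U x" "w \<in> ?W" "E u w" for u w
    using K_closed[OF wK[OF that] _ E_sym[OF that(3)]] U(1)[OF x] that(1) by blast
  have u0X: "u0 \<in> X" using e0 UX by blast
  \<comment> \<open>In a triangle across the cut, the two vertices on the same side have the same value of \<open>f\<close>,
    so all edges across the cut enter the same fibre component.\<close>
  have uK: "u \<in> K u0" if "u \<in> U x" "w \<in> ?W" "E u w" for u w
  proof (rule cut_edges_linked[OF X(1) UX(1) U(2)[OF x] connW _ _ e0 _ that, where Q = "\<lambda>u w. u \<in> K u0"])
    fix u u' w
    assume *: "u \<in> U x" "u' \<in> U x" "w \<in> ?W" "E u u'" "E u w" "E u' w" "u \<in> K u0"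
    have "f w = f x" using wK[OF *(1,3,5)] K(4)[OF x] by blast
    then have "f u = f u'"
      using f[of u u' w] fu[OF *(1,3,5)] fu[OF *(2,3,6)] * UX by auto
    then show "u' \<in> K u0"
      using K_closed[OF *(7) _ *(4)] K(4)[OF u0X *(7)] * UX by auto
  next
    show "u0 \<in> K u0" using K(1)[OF u0X] .
  qed
  have disj: "K u0 \<inter> K x = {}"
    using K(4)[OF x] K(4)[OF u0X] fu[OF e0] by force
  have KU: "K u0 \<subseteq> U x"
    unfolding U_def
    using component_maximal[OF K(2)[OF u0X], of "X - K x" "\<alpha> x" u0] K[OF u0X] disj e0(1) \<alpha>K[OF x K(1)[OF x]]
    unfolding U_def by blast
  \<comment> \<open>Here minimality enters: \<open>u0\<close> lies in \<open>U x\<close> but not in \<open>U u0\<close>.\<close>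
  have "U u0 \<inter> ?W \<noteq> {}"
  proof
    assume "U u0 \<inter> ?W = {}"
    then have "U u0 \<subset> U x"
      using U(1)[OF u0X] K(1)[OF u0X] e0(1) by blast
    then have "card (U u0) < card (U x)"
      using psubset_card_mono finite_subset[OF UX(1) X(2)] by blast
    then show False using min[OF u0X] by simp
  qed
  then obtain z where z: "z \<in> U u0" "z \<in> ?W" by blast
  \<comment> \<open>Edges across the cut have an end in \<open>K u0\<close>, which \<open>U u0\<close> avoids, so \<open>U u0\<close> lies on one side.\<close>
  have "\<alpha> u0 \<in> ?W"
  proof (rule connD[OF U(2)[OF u0X], of "\<lambda>z. z \<in> ?W" z])
    fix y y' assume "y \<in> U u0" "y' \<in> U u0" "E y y'" "y \<in> ?W"
    then show "y' \<in> ?W" using uK[of y' y] U(1)[OF u0X] E_sym by blast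
  qed (use z U(3)[OF u0X] in auto)
  moreover have "\<alpha> w0 \<in> U x" using \<alpha>KU[OF x wK[OF e0]] .
  moreover have "E (\<alpha> w0) (\<alpha> u0)" using \<alpha>(2) e0 u0X E_sym by blast
  ultimately have "\<alpha> w0 \<in> K u0" using uK by blast
  then have "f (\<alpha> w0) = f u0" using K(4)[OF u0X] by blast
  then show False using no[of w0 u0] e0 u0X E_sym by blast
qed

section \<open>Folding and gluing\<close>

lemma simply_conn_singleton: "simply_conn {p}"
proof -
  have "\<not> \<phi> p p" if "cocycle_on {p} \<phi>" for \<phi>
    using that E_refl[of p] unfolding cocycle_on_def by blast
  moreover have "conn {p}" by (rule connI) simp
  ultimately show ?thesis unfolding simply_conn_def coboundary_on_def by blast
qed

text \<open>The condition on \<open>r\<close> says that \<open>x\<close>, \<open>r x\<close>, \<open>y\<close>, \<open>r y\<close> form a clique for each edge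
  \<open>x\<close>, \<open>y\<close>. So a potential on \<open>S\<close>, corrected by the value of the cocycle on the edge from \<open>x\<close> to
  \<open>r x\<close>, is a potential on \<open>X\<close>. It is stronger than \<open>r\<close> preserving edges and moving points along
  edges, which would leave squares without a diagonal.\<close>

lemma simply_conn_fold:
  assumes S: "simply_conn S" "S \<subseteq> X" "S \<noteq> {}"
    and r: "\<And>x. x \<in> X \<Longrightarrow> r x \<in> S" "\<And>x y. x \<in> X \<Longrightarrow> y \<in> X \<Longrightarrow> E x y \<Longrightarrow> E x (r y)"
  shows "simply_conn X"
proof -
  have rX: "r x \<in> X" "E x (r x)" if "x \<in> X" for x
    using r that S(2) E_refl by blast+
  have rr: "E (r x) (r y)" if "x \<in> X" "y \<in> X" "E x y" for x y
    using r(2)[of "r x" y] r(2)[of y x] rX that E_sym by blast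
  obtain c where c: "c \<in> S" using S(3) by blast
  have "conn X"
  proof (rule conn_base_point)
    show "c \<in> X" using c S by blast
    fix P x assume inv: "\<And>x y. x \<in> X \<Longrightarrow> y \<in> X \<Longrightarrow> E x y \<Longrightarrow> P x \<longleftrightarrow> P y" and x: "x \<in> X"
    have "P x \<longleftrightarrow> P (r x)" using inv rX x by blast
    also have "\<dots> \<longleftrightarrow> P c"
      using conn_constant[of S P "r x" c] S inv c r(1)[OF x] unfolding simply_conn_def by blast
    finally show "P x \<longleftrightarrow> P c" .
  qed
  moreover have "coboundary_on X \<phi>" if \<phi>: "cocycle_on X \<phi>" for \<phi>
  proof -
    have "cocycle_on S \<phi>" using \<phi> S(2) unfolding cocycle_on_def by blast
    from simply_conn_potential[OF S(1) this] obtain \<psi> :: "'a \<Rightarrow> bool"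
      where \<psi>: "\<And>x y. x \<in> S \<Longrightarrow> y \<in> S \<Longrightarrow> E x y \<Longrightarrow> \<phi> x y = (\<psi> x \<noteq> \<psi> y)" by metis
    have "\<phi> x y = ((\<psi> (r x) \<noteq> \<phi> x (r x)) \<noteq> (\<psi> (r y) \<noteq> \<phi> y (r y)))"
      if xy: "x \<in> X" "y \<in> X" "E x y" for x y
    proof -
      have "\<phi> x (r y) = (\<phi> x y \<noteq> \<phi> y (r y))"
        using \<phi> xy rX r unfolding cocycle_on_def by blast
      moreover have "\<phi> x (r y) = (\<phi> x (r x) \<noteq> \<phi> (r x) (r y))"
        using \<phi> xy rX r(2)[OF xy] rr[OF xy] unfolding cocycle_on_def by blast
      moreover have "\<phi> (r x) (r y) = (\<psi> (r x) \<noteq> \<psi> (r y))"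
        using \<psi> r(1) rr xy by blast
      ultimately show ?thesis by argo
    qed
    then show ?thesis unfolding coboundary_on_def
      by (intro exI[of _ "\<lambda>x. \<psi> (r x) \<noteq> \<phi> x (r x)"]) blast
  qed
  ultimately show ?thesis by (simp add: simply_conn_def)
qed

text \<open>This is the Mayer-Vietoris argument. Potentials on \<open>S\<close> and \<open>T\<close> fit together once their
  discrepancy on the edges between \<open>S\<close> and \<open>T\<close> is constant. All these edges start in \<open>L\<close>, a triangle
  moves the other end of an edge to the point \<open>u d\<close> opposite to \<open>d\<close>, and connectivity of \<open>L\<close> then
  compares the edges from \<open>d\<close> to \<open>u d\<close> with each other.\<close>

lemma simply_conn_glue:
  assumes S: "simply_conn S" and T: "simply_conn T"
    and L: "conn L" "L \<subseteq> S" "L \<noteq> {}"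
    and u: "\<And>d. d \<in> L \<Longrightarrow> u d \<in> T" "\<And>d e. d \<in> L \<Longrightarrow> e \<in> L \<Longrightarrow> E d e \<Longrightarrow> E d (u e)"
    and cross: "\<And>d t. d \<in> S \<Longrightarrow> t \<in> T \<Longrightarrow> E d t \<Longrightarrow> d \<in> L \<and> E t (u d)"
  shows "simply_conn (S \<union> T)"
proof -
  obtain c where c: "c \<in> L" using L(3) by blast
  have uu: "E d (u d)" if "d \<in> L" for d using u(2) that E_refl by blast
  have "conn (S \<union> T)"
    using conn_union[of S T c "u c"] S T c L u(1) uu unfolding simply_conn_def by blast
  moreover have "coboundary_on (S \<union> T) \<phi>" if \<phi>: "cocycle_on (S \<union> T) \<phi>" for \<phi>
  proof -
    have tri: "\<phi> x z = (\<phi> x y \<noteq> \<phi> y z)"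
      if "x \<in> S \<union> T" "y \<in> S \<union> T" "z \<in> S \<union> T" "E x y" "E y z" "E x z" for x y z
      using \<phi> that unfolding cocycle_on_def by blast
    have sym: "\<phi> x y = \<phi> y x" if "x \<in> S \<union> T" "y \<in> S \<union> T" "E x y" for x y
      using tri[of x x x] tri[of x y x] that E_refl E_sym by blast
    have "cocycle_on S \<phi>" using \<phi> unfolding cocycle_on_def by blast
    from simply_conn_potential[OF S this] obtain \<psi>S :: "'a \<Rightarrow> bool"
      where \<psi>S: "\<And>x y. x \<in> S \<Longrightarrow> y \<in> S \<Longrightarrow> E x y \<Longrightarrow> \<phi> x y = (\<psi>S x \<noteq> \<psi>S y)" by metis
    have "cocycle_on T \<phi>" using \<phi> unfolding cocycle_on_def by blast
    from simply_conn_potential[OF T this] obtain \<psi>T :: "'a \<Rightarrow> bool"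
      where \<psi>T: "\<And>x y. x \<in> T \<Longrightarrow> y \<in> T \<Longrightarrow> E x y \<Longrightarrow> \<phi> x y = (\<psi>T x \<noteq> \<psi>T y)" by metis
    define \<delta> where "\<delta> d t \<longleftrightarrow> (\<phi> d t \<noteq> (\<psi>S d \<noteq> \<psi>T t))" for d t
    have up: "\<delta> d t \<longleftrightarrow> \<delta> d (u d)" if "d \<in> S" "t \<in> T" "E d t" for d t
    proof -
      have *: "d \<in> L" "E t (u d)" using cross that by blast+
      then have "\<phi> d (u d) = (\<phi> d t \<noteq> \<phi> t (u d))"
        using tri that u(1) uu by blast
      moreover have "\<phi> t (u d) = (\<psi>T t \<noteq> \<psi>T (u d))" using \<psi>T * that u(1) by blast
      ultimately show ?thesis unfolding \<delta>_def by argo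
    qed
    have along: "\<delta> d (u d) \<longleftrightarrow> \<delta> e (u e)" if "d \<in> L" "e \<in> L" "E d e" for d e
    proof -
      have "\<phi> d (u e) = (\<phi> d e \<noteq> \<phi> e (u e))"
        using tri[of d e "u e"] that u uu L(2) by blast
      moreover have "\<phi> d e = (\<psi>S d \<noteq> \<psi>S e)" using \<psi>S that L(2) by blast
      ultimately have "\<delta> d (u e) \<longleftrightarrow> \<delta> e (u e)" unfolding \<delta>_def by argo
      then show ?thesis using up[of d "u e"] that u L(2) by blast
    qed
    have const: "\<delta> d t \<longleftrightarrow> \<delta> c (u c)" if "d \<in> S" "t \<in> T" "E d t" for d t
      using up[OF that] conn_constant[OF L(1), of "\<lambda>d. \<delta> d (u d)" d c] along cross[OF that] c
      by blast
    define \<psi> where "\<psi> x \<longleftrightarrow> (if x \<in> S then \<psi>S x else \<psi>T x \<noteq> \<delta> c (u c))" for x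
    have "\<phi> x y = (\<psi> x \<noteq> \<psi> y)" if "x \<in> S \<union> T" "y \<in> S \<union> T" "E x y" for x y
    proof (cases "x \<in> S"; cases "y \<in> S")
      assume "x \<in> S" "y \<notin> S"
      then show ?thesis using const[of x y] that unfolding \<delta>_def \<psi>_def by auto
    next
      assume "x \<notin> S" "y \<in> S"
      then show ?thesis using const[of y x] that E_sym sym[of x y] unfolding \<delta>_def \<psi>_def by auto
    qed (use \<psi>S[of x y] \<psi>T[of x y] that in \<open>auto simp: \<psi>_def\<close>)
    then show ?thesis unfolding coboundary_on_def by blast
  qed
  ultimately show ?thesis by (simp add: simply_conn_def)
qed

end

section \<open>Boxes and their boundaries\<close>

definition near :: "'i set \<Rightarrow> ('i \<Rightarrow> int) \<Rightarrow> ('i \<Rightarrow> int) \<Rightarrow> bool" where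
  "near I x y \<longleftrightarrow> (\<forall>i\<in>I. \<bar>x i - y i\<bar> \<le> 1)"

interpretation king: reflexive_graph "near I" for I :: "'i set"
  by unfold_locales (auto simp: near_def abs_minus_commute)

text \<open>The bounds of a brick may agree in some coordinates. This covers the faces and layers of a
  box as well, so that they need not be treated as boxes of lower dimension.\<close>

definition brick :: "'i set \<Rightarrow> ('i \<Rightarrow> int) \<Rightarrow> ('i \<Rightarrow> int) \<Rightarrow> ('i \<Rightarrow> int) set" where
  "brick I a b = (\<Pi>\<^sub>E i\<in>I. {a i..b i})"

text \<open>With all coordinates in \<open>J\<close> this is the boundary of the box. In a middle layer, where the
  coordinate \<open>k\<close> is constant, the boundary consists of the points that are extremal in a coordinate
  other than \<open>k\<close>, which is the shell for \<open>J - {k}\<close>.\<close>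

definition shell :: "'i set \<Rightarrow> 'i set \<Rightarrow> ('i \<Rightarrow> int) \<Rightarrow> ('i \<Rightarrow> int) \<Rightarrow> ('i \<Rightarrow> int) set" where
  "shell I J a b = {x \<in> brick I a b. \<exists>i\<in>J. x i = a i \<or> x i = b i}"

lemma brick_iff:
  "x \<in> brick I a b \<longleftrightarrow> x \<in> extensional I \<and> (\<forall>i\<in>I. a i \<le> x i \<and> x i \<le> b i)"
  by (auto simp: brick_def PiE_iff)

lemma brick_upd:
  assumes "x \<in> brick I a b" "k \<in> I" "a k \<le> v" "v \<le> b k"
  shows "x(k := v) \<in> brick I a b"
  using assms by (auto simp: brick_iff extensional_def)

lemma corner_in_brick: "(\<And>i. i \<in> I \<Longrightarrow> a i \<le> b i) \<Longrightarrow> restrict a I \<in> brick I a b"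
  by (auto simp: brick_iff)

text \<open>The top layer in any direction folds onto the layer below, until one point is left.\<close>

lemma simply_conn_brick:
  assumes "finite I" "\<And>i. i \<in> I \<Longrightarrow> a i \<le> b i"
  shows "king.simply_conn I (brick I a b)"
  using assms(2)
proof (induction "\<Sum>i\<in>I. nat (b i - a i)" arbitrary: b rule: less_induct)
  case less
  show ?case
  proof (cases "\<exists>k\<in>I. a k < b k")
    case False
    then have "brick I a b = {restrict a I}"
      using less.prems unfolding brick_iff set_eq_iff singleton_iff
      by (auto simp: fun_eq_iff extensional_def) (metis order_antisym not_le)
    then show ?thesis using king.simply_conn_singleton by simp
  next
    case True
    then obtain k where k: "k \<in> I" "a k < b k" by blast
    define b' where "b' = b(k := b k - 1)"
    have b': "a i \<le> b' i" if "i \<in> I" for i using less.prems[OF that] k by (auto simp: b'_def)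
    have "(\<Sum>i\<in>I. nat (b' i - a i)) < (\<Sum>i\<in>I. nat (b i - a i))"
      using k assms(1) by (intro sum_strict_mono_ex1) (auto simp: b'_def)
    from less.hyps[OF this b'] have S: "king.simply_conn I (brick I a b')" by blast
    show ?thesis
    proof (rule king.simply_conn_fold[OF S, where r = "\<lambda>x. x(k := min (x k) (b k - 1))"])
      show "brick I a b' \<subseteq> brick I a b"
        by (force simp: brick_iff b'_def split: if_splits)
      show "brick I a b' \<noteq> {}" using corner_in_brick[of I a b'] b' by blast
    next
      fix x assume "x \<in> brick I a b"
      then show "x(k := min (x k) (b k - 1)) \<in> brick I a b'"
        using k by (auto simp: brick_iff b'_def extensional_def)
    next
      fix x y assume "x \<in> brick I a b" "y \<in> brick I a b" "near I x y"
      then show "near I x (y(k := min (y k) (b k - 1)))"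
        using k by (force simp: near_def brick_iff min_def)
    qed
  qed
qed

text \<open>Below the top face, a point above the bottom face is extremal in a coordinate other than
  \<open>k\<close>, so it stays in the shell when it is lowered. Layer by layer, everything folds onto the
  bottom face, which is a brick.\<close>

lemma simply_conn_open_shell:
  assumes I: "finite I" "\<And>i. i \<in> I \<Longrightarrow> a i \<le> b i" and J: "J \<subseteq> I" "k \<in> J"
    and "a k \<le> c" "c < b k"
  shows "king.simply_conn I {x \<in> shell I J a b. x k \<le> c}"
  using assms(5,6)
proof (induction c rule: int_ge_induct)
  case base
  have "{x \<in> shell I J a b. x k \<le> a k} = brick I a (b(k := a k))"
    using J I(2) base by (force simp: shell_def brick_iff split: if_splits)
  then show ?case using simply_conn_brick[OF I(1), of a "b(k := a k)"] I(2) by auto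
next
  case (step c)
  let ?X = "{x \<in> shell I J a b. x k \<le> c + 1}" and ?S = "{x \<in> shell I J a b. x k \<le> c}"
  have S: "king.simply_conn I ?S" using step by simp
  have k: "k \<in> I" using J by blast
  show ?case
  proof (rule king.simply_conn_fold[OF S, where r = "\<lambda>x. x(k := min (x k) c)"])
    show "?S \<subseteq> ?X" by auto
    have "restrict a I \<in> ?S" using corner_in_brick[of I a b] I(2) J k step by (auto simp: shell_def)
    then show "?S \<noteq> {}" by blast
  next
    fix x assume x: "x \<in> ?X"
    then obtain i where i: "i \<in> J" "x i = a i \<or> x i = b i" by (auto simp: shell_def)
    have "x(k := min (x k) c) \<in> brick I a b"
      using x step k by (intro brick_upd) (auto simp: shell_def brick_iff)
    moreover have "\<exists>i\<in>J. (x(k := min (x k) c)) i = a i \<or> (x(k := min (x k) c)) i = b i"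
      using i x step by (intro bexI[OF _ i(1)]) auto
    ultimately show "x(k := min (x k) c) \<in> ?S" by (simp add: shell_def)
  next
    fix x y assume "x \<in> ?X" "y \<in> ?X" "near I x y"
    then show "near I x (y(k := min (y k) c))"
      using k by (force simp: near_def min_def)
  qed
qed

lemma top_face_eq:
  assumes "k \<in> I"  "a k \<le> b k"
  shows "brick I (a(k := b k)) b = {x \<in> brick I a b. x k = b k}"
  using assms by (force simp: brick_iff split: if_splits)

lemma shell_split:
  assumes "J \<subseteq> I" "k \<in> J" "a k \<le> b k"
  shows "shell I J a b = {x \<in> shell I J a b. x k \<le> b k - 1} \<union> brick I (a(k := b k)) b"
proof -
  have "x k \<le> b k" if "x \<in> shell I J a b" for x
    using that assms by (auto simp: shell_def brick_iff)
  moreover have "brick I (a(k := b k)) b = {x \<in> shell I J a b. x k = b k}"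
    using top_face_eq[of k I a b] assms by (auto simp: shell_def)
  ultimately show ?thesis by force
qed

text \<open>A second coordinate \<open>l\<close> in \<open>J\<close> provides an edge between the top face and the rest; with \<open>J = {k}\<close>
  the shell consists of two opposite faces only, which may be far apart.\<close>

lemma conn_shell:
  assumes I: "finite I" "\<And>i. i \<in> I \<Longrightarrow> a i \<le> b i"
    and J: "J \<subseteq> I" "k \<in> J" "l \<in> J" "k \<noteq> l" and "a k < b k"
  shows "king.conn I (shell I J a b)"
proof -
  let ?D = "{x \<in> shell I J a b. x k \<le> b k - 1}" and ?T = "brick I (a(k := b k)) b"
  let ?p = "(restrict a I)(k := b k - 1)"
  have kI: "k \<in> I" using J by blast
  have "king.conn I ?D"
    using simply_conn_open_shell[OF I J(1,2), where c = "b k - 1"] assms(7)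
    by (simp add: king.simply_conn_def)
  moreover have "king.conn I ?T"
    using simply_conn_brick[OF I(1), of "a(k := b k)" b] I(2) by (simp add: king.simply_conn_def)
  moreover have "?p \<in> brick I a b"
    using corner_in_brick[of I a b] I(2) kI assms(7) by (intro brick_upd) auto
  then have "?p \<in> ?D" using J assms(7) by (auto simp: shell_def intro!: bexI[of _ l])
  moreover have "(restrict a I)(k := b k) \<in> ?T"
    unfolding top_face_eq[of k I a b, OF kI I(2)[OF kI]]
    using corner_in_brick[of I a b] I(2) kI by (auto intro: brick_upd)
  moreover have "near I ?p ((restrict a I)(k := b k))" by (simp add: near_def)
  ultimately have "king.conn I (?D \<union> ?T)" by (rule king.conn_union)
  then show ?thesis using shell_split[of J I k a b] J assms(7) by simp
qed

lemma shell_layer: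
  assumes "J \<subseteq> I" "k \<in> J" "a k < c" "c < b k"
  shows "{x \<in> shell I J a b. x k = c} = shell I (J - {k}) (a(k := c)) (b(k := c))"
  using assms by (force simp: shell_def brick_iff split: if_splits)

text \<open>The part below the top face and the top face itself are glued along the layer \<open>?L\<close> just below
  that face. If the box has height 1, this layer is the whole bottom face; otherwise it is a shell
  with one coordinate less, which is connected because two coordinates \<open>l\<close> and \<open>m\<close> remain.\<close>

lemma simply_conn_shell:
  assumes I: "finite I" "\<And>i. i \<in> I \<Longrightarrow> a i \<le> b i"
    and J: "J \<subseteq> I" "{k, l, m} \<subseteq> J" "k \<noteq> l" "k \<noteq> m" "l \<noteq> m" and less: "a k < b k" "a l < b l"
  shows "king.simply_conn I (shell I J a b)"
proof -
  let ?D = "{x \<in> shell I J a b. x k \<le> b k - 1}" and ?T = "brick I (a(k := b k)) b"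
  let ?L = "{x \<in> shell I J a b. x k = b k - 1}"
  have kI: "k \<in> I" using J by blast
  have T: "?T = {x \<in> brick I a b. x k = b k}" using top_face_eq[of k I a b, OF kI I(2)[OF kI]] .
  have D: "king.simply_conn I ?D"
    using simply_conn_open_shell[OF I J(1), where k = k and c = "b k - 1"] J less by simp
  have T': "king.simply_conn I ?T"
    using simply_conn_brick[OF I(1), of "a(k := b k)" b] I(2) by simp
  have L: "king.conn I ?L"
  proof (cases "a k = b k - 1")
    case True
    then have "?L = brick I a (b(k := a k))"
      using J kI by (force simp: shell_def brick_iff split: if_splits)
    then show ?thesis
      using simply_conn_brick[OF I(1), of a "b(k := a k)"] I(2) by (auto simp: king.simply_conn_def)
  next
    case False
    then have "?L = shell I (J - {k}) (a(k := b k - 1)) (b(k := b k - 1))"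
      using shell_layer[of J I k a "b k - 1" b] J less by simp
    moreover have "king.conn I (shell I (J - {k}) (a(k := b k - 1)) (b(k := b k - 1)))"
      using J less I by (intro conn_shell[where k = l and l = m]) auto
    ultimately show ?thesis by simp
  qed
  have "king.simply_conn I (?D \<union> ?T)"
  proof (rule king.simply_conn_glue[OF D T' L, where u = "\<lambda>x. x(k := b k)"])
    show "?L \<subseteq> ?D" by auto
    have "(restrict a I)(k := b k - 1) \<in> brick I a b"
      using corner_in_brick[of I a b] I(2) kI less by (intro brick_upd) auto
    then have "(restrict a I)(k := b k - 1) \<in> ?L"
      using J by (auto simp: shell_def intro!: bexI[of _ l])
    then show "?L \<noteq> {}" by blast
  next
    fix d assume "d \<in> ?L"
    then show "d(k := b k) \<in> ?T" unfolding T using kI I(2)[OF kI] by (auto simp: shell_def intro: brick_upd)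
  next
    fix d e assume "d \<in> ?L" "e \<in> ?L" "near I d e"
    then show "near I d (e(k := b k))" by (simp add: near_def)
  next
    fix d t assume "d \<in> ?D" "t \<in> ?T" "near I d t"
    then show "d \<in> ?L \<and> near I t (d(k := b k))"
      unfolding T using kI by (force simp: near_def abs_minus_commute)
  qed
  then show ?thesis using shell_split[of J I k a b] J less by simp
qed

lemma finite_shell: "finite I \<Longrightarrow> finite (shell I J a b)"
  unfolding shell_def brick_def by (rule finite_subset[OF Collect_restrict], rule finite_PiE) auto

section \<open>Digitally continuous maps on the boundary\<close>

lemma box_boundary_shell: "box_boundary n a b = shell {1..n} {1..n} a b"
  by (auto simp: box_boundary_def shell_def int_box_def brick_def)

lemma near_c_adj:
  assumes "x \<in> lattice_points n" "y \<in> lattice_points n" "near {1..n} x y" "x \<noteq> y"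
  shows "c_adj n n x y"
  using assms unfolding c_adj_def near_def by (auto intro!: exI[of _ "{1..n}"])

lemma near_antipode: "near {1..n} x y \<Longrightarrow> near {1..n} (antipode n a b x) (antipode n a b y)"
  by (auto simp: near_def antipode_def)

lemma c1_adjE:
  assumes "c_adj m 1 x y"
  obtains i where "i \<in> {1..m}" "\<bar>x i - y i\<bar> = 1" "\<And>j. j \<noteq> i \<Longrightarrow> x j = y j"
proof -
  obtain S where S: "S \<subseteq> {1..m}" "card S \<le> 1" "\<forall>i\<in>S. \<bar>x i - y i\<bar> \<le> 1" "\<forall>i\<in>{1..m} - S. x i = y i"
    and xy: "x \<in> lattice_points m" "y \<in> lattice_points m" "x \<noteq> y"
    using assms unfolding c_adj_def by blast
  have out: "x i = y i" if "i \<notin> {1..m}" for i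
    using xy(1,2) that by (auto simp: lattice_points_def PiE_iff extensional_def)
  obtain i where i: "x i \<noteq> y i" using xy(3) by blast
  then have "i \<in> S" using out S(4) by blast
  then have "S = {i}"
    using S(2) card_le_Suc0_iff_eq[OF finite_subset[OF S(1)]] by auto
  show thesis
  proof
    show "i \<in> {1..m}" using \<open>i \<in> S\<close> S(1) by blast
    show "\<bar>x i - y i\<bar> = 1" using S(3) \<open>i \<in> S\<close> i by force
    show "x j = y j" if "j \<noteq> i" for j using that out S(4) \<open>S = {i}\<close> by blast
  qed
qed

text \<open>The graph of \<open>c\<^sub>1\<close> is bipartite; in particular it contains no triangle.\<close>

lemma c1_adj_parity:
  assumes "c_adj m 1 x y"
  shows "even (\<Sum>i\<in>{1..m}. x i) \<longleftrightarrow> odd (\<Sum>i\<in>{1..m}. y i)"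
proof -
  obtain i where i: "i \<in> {1..m}" "\<bar>x i - y i\<bar> = 1" "\<And>j. j \<noteq> i \<Longrightarrow> x j = y j"
    using c1_adjE[OF assms] by metis
  have "(\<Sum>j\<in>{1..m}. x j) = x i + (\<Sum>j\<in>{1..m} - {i}. x j)"
       "(\<Sum>j\<in>{1..m}. y j) = y i + (\<Sum>j\<in>{1..m} - {i}. y j)"
    using i(1) by (simp_all add: sum.remove)
  moreover have "(\<Sum>j\<in>{1..m} - {i}. x j) = (\<Sum>j\<in>{1..m} - {i}. y j)"
    using i(3) by (intro sum.cong) auto
  moreover have "x i = y i + 1 \<or> x i = y i - 1" using i(2) by linarith
  ultimately show ?thesis by auto
qed

lemma antipode_antipode:
  assumes "x \<in> box_boundary n a b"
  shows "antipode n a b (antipode n a b x) = x"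
  using assms by (auto simp: box_boundary_def int_box_def antipode_def PiE_iff extensional_def fun_eq_iff)

lemma c_adj_line:
  assumes "x \<in> lattice_points 1" "y \<in> lattice_points 1" "\<bar>x 1 - y 1\<bar> \<le> 1"
  shows "x = y \<or> c_adj 1 1 x y"
  using assms unfolding c_adj_def by (auto intro!: exI[of _ "{1}"])

text \<open>The difference \<open>f x - f (-x)\<close> changes by at most 2 along an edge. If its absolute value were
  always at least 2, it could not change sign along an edge, hence not at all, while it takes opposite
  values at antipodes.\<close>

lemma coincidence_on_circle:
  assumes ab: "\<forall>i\<in>{1..2}. a i < b i"
    and f: "digitally_continuous (box_boundary 2 a b) (c_adj 2 2) (lattice_points 1) (c_adj 1 1) f"
  shows "\<exists>x\<in>box_boundary 2 a b. \<bar>f x 1 - f (antipode 2 a b x) 1\<bar> \<le> 1"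
proof (rule ccontr)
  let ?X = "box_boundary 2 a b" and ?\<alpha> = "antipode 2 a b"
  define g where "g x = f x 1 - f (?\<alpha> x) 1" for x
  assume "\<not> ?thesis"
  then have big: "\<bar>g x\<bar> > 1" if "x \<in> ?X" for x using that by (force simp: g_def)
  have step: "\<bar>f x 1 - f y 1\<bar> \<le> 1" if "x \<in> ?X" "y \<in> ?X" "near {1..2} x y" for x y
  proof (cases "x = y")
    case False
    have "x \<in> lattice_points 2" "y \<in> lattice_points 2"
      using that(1,2) by (auto simp: box_boundary_def int_box_def lattice_points_def PiE_iff)
    then have "c_adj 1 1 (f x) (f y) \<or> f x = f y"
      using f near_c_adj[OF _ _ that(3) False] that(1,2) unfolding digitally_continuous_def by blast
    then show ?thesis
    proof
      assume "c_adj 1 1 (f x) (f y)"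
      then show ?thesis by (rule c1_adjE) (metis abs_0 diff_self order_refl zero_le_one)
    qed simp
  qed simp
  have conn: "king.conn {1..2} ?X"
    unfolding box_boundary_shell
    using ab by (intro conn_shell[where k = 1 and l = 2]) (auto intro: less_imp_le)
  have "restrict a {1..2} \<in> ?X"
    using corner_in_brick[of "{1..2}" a b] ab
    by (auto simp: box_boundary_shell shell_def less_imp_le)
  then obtain p where p: "p \<in> ?X" by blast
  have \<alpha>X: "?\<alpha> x \<in> ?X" if "x \<in> ?X" for x using antipode_in_box_boundary[OF that] .
  have "g p > 0 \<longleftrightarrow> g (?\<alpha> p) > 0"
  proof (rule king.conn_constant[OF conn, where P = "\<lambda>x. g x > 0"])
    fix x y assume xy: "x \<in> ?X" "y \<in> ?X" "near {1..2} x y"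
    then show "g x > 0 \<longleftrightarrow> g y > 0"
      using step[OF xy] step[OF \<alpha>X \<alpha>X near_antipode] big[OF xy(1)] big[OF xy(2)]
      unfolding g_def by fastforce
  qed (use p \<alpha>X in auto)
  moreover have "g (?\<alpha> p) = - g p" using antipode_antipode[OF p] by (simp add: g_def)
  ultimately show False using big[OF p] by auto
qed

theorem theorem5p4:
  fixes n :: nat and a b :: "nat \<Rightarrow> int" and f :: "(nat \<Rightarrow> int) \<Rightarrow> (nat \<Rightarrow> int)"
  assumes "n \<ge> 2"
    and "\<forall>i\<in>{1..n}. a i < b i"
    and "digitally_continuous (box_boundary n a b) (c_adj n n)
           (lattice_points (n - 1)) (c_adj (n - 1) 1) f"
  shows "\<exists>x\<in>box_boundary n a b.
           f x = f (antipode n a b x) \<or> c_adj (n - 1) 1 (f x) (f (antipode n a b x))"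
proof -
  let ?X = "box_boundary n a b" and ?\<alpha> = "antipode n a b"
  have \<alpha>X: "?\<alpha> x \<in> ?X" if "x \<in> ?X" for x using antipode_in_box_boundary[OF that] .
  have fX: "f x \<in> lattice_points (n - 1)" if "x \<in> ?X" for x
    using assms(3) that unfolding digitally_continuous_def by blast
  have cont: "f x = f y \<or> c_adj (n - 1) 1 (f x) (f y)" if "x \<in> ?X" "y \<in> ?X" "near {1..n} x y" for x y
  proof (cases "x = y")
    case False
    have "x \<in> lattice_points n" "y \<in> lattice_points n"
      using that(1,2) by (auto simp: box_boundary_def int_box_def lattice_points_def PiE_iff)
    then show ?thesis
      using assms(3) near_c_adj[OF _ _ that(3) False] that(1,2) unfolding digitally_continuous_def by blast
  qed simp
  show ?thesis
  proof (cases "n = 2")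
    case True
    then obtain x where x: "x \<in> ?X" "\<bar>f x 1 - f (?\<alpha> x) 1\<bar> \<le> 1"
      using coincidence_on_circle[of a b f] assms(2,3) by auto
    then show ?thesis using c_adj_line[of "f x" "f (?\<alpha> x)"] fX \<alpha>X True by auto
  next
    case False
    then have n: "n \<ge> 3" using assms(1) by simp
    have "king.simply_conn {1..n} ?X"
      unfolding box_boundary_shell
      using assms(2) n
      by (intro simply_conn_shell[where k = 1 and l = 2 and m = 3]) (auto intro: less_imp_le)
    moreover have "finite ?X" by (simp add: box_boundary_shell finite_shell)
    moreover have "restrict a {1..n} \<in> ?X"
      using corner_in_brick[of "{1..n}" a b] assms(2) n
      by (auto simp: box_boundary_shell shell_def less_imp_le intro!: bexI[of _ 1])
    then have "?X \<noteq> {}" by blast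
    moreover have "f x = f y \<or> f y = f z \<or> f x = f z"
      if "x \<in> ?X" "y \<in> ?X" "z \<in> ?X" "near {1..n} x y" "near {1..n} y z" "near {1..n} x z" for x y z
      using cont[OF that(1,2,4)] cont[OF that(2,3,5)] cont[OF that(1,3,6)] c1_adj_parity by blast
    ultimately have "\<exists>x\<in>?X. \<exists>y\<in>?X. near {1..n} x y \<and> f (?\<alpha> x) = f y"
      using \<alpha>X near_antipode by (intro king.near_coincidence) auto
    then show ?thesis using cont by metis
  qed
qed

end
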